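(* The categories $\tilde\nabla$ and $\tilde\Delta$ are isomorphic. The isomorphism is given by the functor $F:\tilde\Delta\to\tilde\nabla$ defined as follows. On objects, $F([n])=[[n]]$. For $\chi\in\operatorname{Hom}_\Delta([n],[m])\subset\operatorname{Hom}_{\tilde\Delta}([n],[m])$, $F(\chi)$ is the morphism represented by $$F(\chi)(a+r(n+1))=\chi(a)+r(m+1),\qquad 0\le a<n+1,\ r\in\mathbb{Z}.$$ For $u\in K([n])$, $F(u):[[n]]\to[[n]]$ is translation by $u$. In general, $F(\chi\circ u)=F(\chi)\circ F(u)$.
   Context: For $n\ge 0$, $[n]=\{0<1<\cdots<n\}$; $\Delta$ is the category with objects $[n]$, $n\ge0$, and order preserving (weakly monotone) maps as morphisms. $K([n])=\mathbb{Z}/(n+1)$ is regarded as the group of cyclic permutations (translations modulo $n+1$) of $[n]$. The category $\tilde\Delta$ (the cyclic category of Connes) has the same objects as $\Delta$, with $\operatorname{Hom}_{\tilde\Delta}([n],[m])=\operatorname{Hom}_\Delta([n],[m])\times K([n])$, and the composition of $(\phi,u)\in\operatorname{Hom}_\Delta([m],[k])\times K([m])$ and $(\chi,v)\in\operatorname{Hom}_\Delta([n],[m])\times K([n])$ is $$(\phi,u)\circ(\chi,v)=(\phi\circ u_*\chi,\ \chi^*u\circ v),$$ where $u_*\chi$ and $\chi^*u$ are defined as follows. For $i\in[m]$ let $A_i=\chi^{-1}(i)$ and $B_{u(i)}=A_i$. Give $[n]$ a new ordering as the ordered union $B_0,B_1,\ldots,B_m$ (each $B_i$ with the order induced from $[n]$).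 The cyclic permutation $\chi^*u\in K([n])$ is the unique bijection of $[n]$ which is order preserving from $[n]$ with the new ordering to $[n]$ with the standard one, and $u_*\chi:=u\chi(\chi^*u)^{-1}$, an order preserving map $[n]\to[m]$. For $\chi\in\operatorname{Hom}_\Delta([n],[m])$ and $v\in K([n])$, one writes $\chi$ for $(\chi,\operatorname{id})$ and $v$ for $(\operatorname{id},v)$; then $(\chi,v)=\chi\circ v$. A periodic partially ordered set (ppset) of degree $1$ is a partially ordered set $P$ together with an action of $\mathbb{Z}$ by order preserving automorphisms, i.e. with an order preserving automorphism $T_1$ (the generator); the elements of the group action are called shifts. A map of degree $1$ ppsets $f:P\to Q$ is an order preserving function with $f\circ T_1=T_1\circ f$. A morphism is an equivalence class of maps, under precomposition with shifts of $P$ and postcomposition with shifts of $Q$. $\mathcal{PP}_1$ is the category of degree $1$ ppsets with these morphisms (composition induced by composition of maps). For $n\ge0$, the standard ppset $[[n]]$ is $\mathbb{Z}$ with its usual order and $T_1$ translation by $n+1$. $\tilde\nabla$ is the (full) subcategory of $\mathcal{PP}_1$ whose objects are $[[n]]$, $n=0,1,2,\ldots$. (Translation by $u\in\mathbb{Z}/(n+1)$ is well defined as a morphism $[[n]]\to[[n]]$, since translations by multiples of $n+1$ are shifts.) *)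

theory Defs
  imports "HOL-Library.FuncSet" "HOL-Algebra.Group_Action" "HOL-Algebra.Elementary_Groups"
begin

section \<open>Categories, functors, isomorphisms of categories\<close>

text \<open>Hom-sets are indexed by source and target and need not be disjoint.
  \<open>Comp C a b c g f\<close> is the composite of \<open>f : a \<rightarrow> b\<close> followed by \<open>g : b \<rightarrow> c\<close>.\<close>

record ('o, 'm) cat =
  Obj :: "'o set"
  Hom :: "'o \<Rightarrow> 'o \<Rightarrow> 'm set"
  Ident :: "'o \<Rightarrow> 'm"
  Comp :: "'o \<Rightarrow> 'o \<Rightarrow> 'o \<Rightarrow> 'm \<Rightarrow> 'm \<Rightarrow> 'm"

definition is_category :: "('o, 'm) cat \<Rightarrow> bool" where
  "is_category C \<longleftrightarrow>
    (\<forall>a\<in>Obj C. Ident C a \<in> Hom C a a) \<and>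
    (\<forall>a\<in>Obj C. \<forall>b\<in>Obj C. \<forall>c\<in>Obj C. \<forall>f\<in>Hom C a b. \<forall>g\<in>Hom C b c.
      Comp C a b c g f \<in> Hom C a c) \<and>
    (\<forall>a\<in>Obj C. \<forall>b\<in>Obj C. \<forall>f\<in>Hom C a b.
      Comp C a a b f (Ident C a) = f \<and> Comp C a b b (Ident C b) f = f) \<and>
    (\<forall>a\<in>Obj C. \<forall>b\<in>Obj C. \<forall>c\<in>Obj C. \<forall>d\<in>Obj C.
      \<forall>f\<in>Hom C a b. \<forall>g\<in>Hom C b c. \<forall>h\<in>Hom C c d.
      Comp C a c d h (Comp C a b c g f) = Comp C a b d (Comp C b c d h g) f)"

record ('o, 'm, 'p, 'n) catmap =
  on_obj :: "'o \<Rightarrow> 'p"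
  on_hom :: "'o \<Rightarrow> 'o \<Rightarrow> 'm \<Rightarrow> 'n"

definition is_functor ::
  "('o, 'm) cat \<Rightarrow> ('p, 'n) cat \<Rightarrow> ('o, 'm, 'p, 'n) catmap \<Rightarrow> bool" where
  "is_functor C D F \<longleftrightarrow> is_category C \<and> is_category D \<and>
    (\<forall>a\<in>Obj C. on_obj F a \<in> Obj D) \<and>
    (\<forall>a\<in>Obj C. \<forall>b\<in>Obj C. \<forall>f\<in>Hom C a b.
      on_hom F a b f \<in> Hom D (on_obj F a) (on_obj F b)) \<and>
    (\<forall>a\<in>Obj C. on_hom F a a (Ident C a) = Ident D (on_obj F a)) \<and>
    (\<forall>a\<in>Obj C. \<forall>b\<in>Obj C. \<forall>c\<in>Obj C. \<forall>f\<in>Hom C a b. \<forall>g\<in>Hom C b c.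
      on_hom F a c (Comp C a b c g f) =
      Comp D (on_obj F a) (on_obj F b) (on_obj F c) (on_hom F b c g) (on_hom F a b f))"

definition left_inverse_functor ::
  "('o, 'm) cat \<Rightarrow> ('p, 'n, 'o, 'm) catmap \<Rightarrow> ('o, 'm, 'p, 'n) catmap \<Rightarrow> bool" where
  "left_inverse_functor C G F \<longleftrightarrow>
    (\<forall>a\<in>Obj C. on_obj G (on_obj F a) = a) \<and>
    (\<forall>a\<in>Obj C. \<forall>b\<in>Obj C. \<forall>f\<in>Hom C a b.
      on_hom G (on_obj F a) (on_obj F b) (on_hom F a b f) = f)"

definition is_cat_isomorphism ::
  "('o, 'm) cat \<Rightarrow> ('p, 'n) cat \<Rightarrow> ('o, 'm, 'p, 'n) catmap \<Rightarrow> bool" where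
  "is_cat_isomorphism C D F \<longleftrightarrow> is_functor C D F \<and>
    (\<exists>G. is_functor D C G \<and> left_inverse_functor C G F \<and> left_inverse_functor D F G)"

definition isomorphic_categories :: "('o, 'm) cat \<Rightarrow> ('p, 'n) cat \<Rightarrow> bool" where
  "isomorphic_categories C D \<longleftrightarrow> (\<exists>F. is_cat_isomorphism C D F)"

definition full_subcategory :: "('o, 'm) cat \<Rightarrow> 'o set \<Rightarrow> ('o, 'm) cat" where
  "full_subcategory C S = C\<lparr>Obj := Obj C \<inter> S\<rparr>"


section \<open>The cyclic category\<close>

text \<open>The object \<open>[n]\<close> is represented by the number \<open>n\<close> and has the elements \<open>{..n}\<close>.
  Functions on \<open>[n]\<close> are extensional, so that equality of functions is HOL equality.\<close>

definition idn :: "nat \<Rightarrow> nat \<Rightarrow> nat" where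
  "idn n = (\<lambda>i\<in>{..n}. i)"

definition hom_Delta :: "nat \<Rightarrow> nat \<Rightarrow> (nat \<Rightarrow> nat) set" where
  "hom_Delta n m = {\<phi> \<in> {..n} \<rightarrow>\<^sub>E {..m}. mono_on {..n} \<phi>}"

definition cyc :: "nat \<Rightarrow> int \<Rightarrow> nat \<Rightarrow> nat" where
  "cyc n c = (\<lambda>i\<in>{..n}. nat ((int i + c) mod (int n + 1)))"

definition K :: "nat \<Rightarrow> (nat \<Rightarrow> nat) set" where
  "K n = range (cyc n)"

text \<open>\<open>block n u \<chi> j\<close> is \<open>B\<^sub>j\<close>: the fibre \<open>A\<^sub>i\<close> of \<open>\<chi>\<close> over the \<open>i\<close> with \<open>u i = j\<close>.\<close>

definition block :: "nat \<Rightarrow> (nat \<Rightarrow> nat) \<Rightarrow> (nat \<Rightarrow> nat) \<Rightarrow> nat \<Rightarrow> nat set" where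
  "block n u \<chi> j = {a \<in> {..n}. u (\<chi> a) = j}"

definition new_order ::
  "nat \<Rightarrow> nat \<Rightarrow> (nat \<Rightarrow> nat) \<Rightarrow> (nat \<Rightarrow> nat) \<Rightarrow> nat rel" where
  "new_order n m u \<chi> =
    {(a, b). \<exists>i\<in>{..m}. \<exists>j\<in>{..m}. a \<in> block n u \<chi> i \<and> b \<in> block n u \<chi> j \<and>
      (i < j \<or> i = j \<and> a \<le> b)}"

text \<open>\<open>upper_star n m \<chi> u\<close> is \<open>\<chi>\<^sup>*u\<close> and \<open>lower_star n m u \<chi>\<close> is \<open>u\<^sub>*\<chi>\<close>,
  for \<open>\<chi> : [n] \<rightarrow> [m]\<close> and \<open>u \<in> K([m])\<close>.\<close>

definition upper_star ::
  "nat \<Rightarrow> nat \<Rightarrow> (nat \<Rightarrow> nat) \<Rightarrow> (nat \<Rightarrow> nat) \<Rightarrow> nat \<Rightarrow> nat" where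
  "upper_star n m \<chi> u =
    (THE \<sigma>. \<sigma> \<in> extensional {..n} \<and> bij_betw \<sigma> {..n} {..n} \<and>
      (\<forall>(a, b) \<in> new_order n m u \<chi>. \<sigma> a \<le> \<sigma> b))"

definition lower_star ::
  "nat \<Rightarrow> nat \<Rightarrow> (nat \<Rightarrow> nat) \<Rightarrow> (nat \<Rightarrow> nat) \<Rightarrow> nat \<Rightarrow> nat" where
  "lower_star n m u \<chi> = (\<lambda>a\<in>{..n}. u (\<chi> (inv_into {..n} (upper_star n m \<chi> u) a)))"

definition Delta_tilde :: "(nat, (nat \<Rightarrow> nat) \<times> (nat \<Rightarrow> nat)) cat" where
  "Delta_tilde =
    \<lparr>Obj = UNIV,
     Hom = (\<lambda>n m. hom_Delta n m \<times> K n),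
     Ident = (\<lambda>n. (idn n, idn n)),
     Comp = (\<lambda>n m k (\<phi>, u) (\<chi>, v).
       (compose {..n} \<phi> (lower_star n m u \<chi>), compose {..n} (upper_star n m \<chi> u) v))\<rparr>"


section \<open>Periodic partially ordered sets of degree 1\<close>

text \<open>\<open>shift P k\<close> is the action of \<open>k \<in> \<int>\<close>; in particular \<open>T\<^sub>1 = shift P 1\<close>.\<close>

record 'a ppset =
  points :: "'a set"
  leq :: "'a rel"
  shift :: "int \<Rightarrow> 'a \<Rightarrow> 'a"

definition is_ppset :: "'a ppset \<Rightarrow> bool" where
  "is_ppset P \<longleftrightarrow> partial_order_on (points P) (leq P) \<and>
    group_action integer_group (points P) (shift P) \<and>
    (\<forall>k. \<forall>(x, y) \<in> leq P. (shift P k x, shift P k y) \<in> leq P)"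

definition ppmaps :: "'a ppset \<Rightarrow> 'a ppset \<Rightarrow> ('a \<Rightarrow> 'a) set" where
  "ppmaps P Q = {f \<in> points P \<rightarrow>\<^sub>E points Q.
    (\<forall>(x, y) \<in> leq P. (f x, f y) \<in> leq Q) \<and>
    (\<forall>x\<in>points P. f (shift P 1 x) = shift Q 1 (f x))}"

definition pprel :: "'a ppset \<Rightarrow> 'a ppset \<Rightarrow> ('a \<Rightarrow> 'a) rel" where
  "pprel P Q = {(f, g). f \<in> ppmaps P Q \<and> g \<in> ppmaps P Q \<and>
    (\<exists>j k. \<forall>x\<in>points P. g x = shift Q j (f (shift P k x)))}"

definition ppclass :: "'a ppset \<Rightarrow> 'a ppset \<Rightarrow> ('a \<Rightarrow> 'a) \<Rightarrow> ('a \<Rightarrow> 'a) set" where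
  "ppclass P Q f = pprel P Q `` {f}"

text \<open>The category of the ppsets whose points lie in the type \<open>'a\<close>. The union in the definition
  of composition is the usual way to induce an operation on equivalence classes from one on
  representatives (compare \<open>UN_equiv_class2\<close>).\<close>

definition PP1 :: "('a ppset, ('a \<Rightarrow> 'a) set) cat" where
  "PP1 =
    \<lparr>Obj = {P. is_ppset P},
     Hom = (\<lambda>P Q. ppmaps P Q // pprel P Q),
     Ident = (\<lambda>P. ppclass P P (\<lambda>x\<in>points P. x)),
     Comp = (\<lambda>P Q R Y X. \<Union>g\<in>Y. \<Union>f\<in>X. ppclass P R (compose (points P) g f))\<rparr>"

definition std :: "nat \<Rightarrow> int ppset" where
  "std n = \<lparr>points = UNIV, leq = {(x, y). x \<le> y}, shift = (\<lambda>k x. x + k * (int n + 1))\<rparr>"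

definition nabla_tilde :: "(int ppset, (int \<Rightarrow> int) set) cat" where
  "nabla_tilde = full_subcategory PP1 (range std)"


section \<open>The functor\<close>

definition lift :: "nat \<Rightarrow> nat \<Rightarrow> (nat \<Rightarrow> nat) \<Rightarrow> int \<Rightarrow> int" where
  "lift n m \<chi> x = int (\<chi> (nat (x mod (int n + 1)))) + (x div (int n + 1)) * (int m + 1)"

lemma lift_apply:
  assumes "a < n + 1"
  shows "lift n m \<chi> (int a + r * (int n + 1)) = int (\<chi> a) + r * (int m + 1)"
proof -
  have a: "0 \<le> int a" "int a < int n + 1"
    using assms by auto
  have "(int a + r * (int n + 1)) mod (int n + 1) = int a"
    using a by (simp add: mod_pos_pos_trivial)
  moreover have "(int a + r * (int n + 1)) div (int n + 1) = r"
    using a by (subst div_mult_self1) (auto simp: div_pos_pos_trivial)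
  ultimately show ?thesis
    by (simp add: lift_def)
qed

definition F_Delta :: "nat \<Rightarrow> nat \<Rightarrow> (nat \<Rightarrow> nat) \<Rightarrow> (int \<Rightarrow> int) set" where
  "F_Delta n m \<chi> = ppclass (std n) (std m) (lift n m \<chi>)"

text \<open>An element \<open>u\<close> of \<open>K([n])\<close> is translation by the residue class of \<open>u 0\<close> modulo \<open>n + 1\<close>.\<close>

definition F_K :: "nat \<Rightarrow> (nat \<Rightarrow> nat) \<Rightarrow> (int \<Rightarrow> int) set" where
  "F_K n u = ppclass (std n) (std n) (\<lambda>x. x + int (u 0))"

definition F :: "(nat, (nat \<Rightarrow> nat) \<times> (nat \<Rightarrow> nat), int ppset, (int \<Rightarrow> int) set) catmap" where
  "F = \<lparr>on_obj = std,
        on_hom = (\<lambda>n m (\<chi>, u).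
          Comp nabla_tilde (std n) (std n) (std m) (F_Delta n m \<chi>) (F_K n u))\<rparr>"

end

theory Submission
  imports Defs
begin

text \<open>
  An equivariant monotone map \<open>f : \<int> \<rightarrow> \<int>\<close> from \<open>[[n]]\<close> to \<open>[[m]]\<close> has a least point \<open>y\<close> with
  \<open>f y \<ge> 0\<close>, and \<open>f (y + _)\<close> maps \<open>{0..n}\<close> into \<open>{0..m}\<close>. Hence \<open>f\<close> is the lift of a unique
  \<open>\<chi>\<close> in \<open>\<Delta>\<close> precomposed with a translation, unique up to shifts; this makes \<open>F\<close> bijective on
  morphisms. Applied to \<open>f = lift \<chi> + c\<close>, the same factorization
  \<open>lift \<chi> x + c = lift \<chi>' (x + d)\<close> computes \<open>u\<^sub>*\<chi> = \<chi>'\<close> and \<open>\<chi>\<^sup>*u\<close> as translation by \<open>d\<close>, so \<open>F\<close>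
  preserves composition. The category axioms for \<open>Delta_tilde\<close> are then pulled back along \<open>F\<close>.
\<close>

section \<open>Transport of category laws along a bijection on objects and morphisms\<close>

text \<open>Injectivity of \<open>\<Phi>\<close> on Hom-sets lets the unit and associativity laws of
  \<open>C\<close> be checked after applying \<open>\<Phi>\<close>, where they hold in
  \<open>D\<close>. The category laws of \<open>C\<close> thus come out as a by-product, which
  spares a direct check of associativity in \<open>Delta_tilde\<close>.\<close>

lemma is_cat_isomorphismI:
  assumes D: "is_category D"
    and obj: "bij_betw (on_obj \<Phi>) (Obj C) (Obj D)"
    and hom: "\<And>a b. a \<in> Obj C \<Longrightarrow> b \<in> Obj C \<Longrightarrow>
      bij_betw (on_hom \<Phi> a b) (Hom C a b) (Hom D (on_obj \<Phi> a) (on_obj \<Phi> b))"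
    and id_closed: "\<And>a. a \<in> Obj C \<Longrightarrow> Ident C a \<in> Hom C a a"
    and comp_closed: "\<And>a b c f g. \<lbrakk>a \<in> Obj C; b \<in> Obj C; c \<in> Obj C; f \<in> Hom C a b; g \<in> Hom C b c\<rbrakk>
      \<Longrightarrow> Comp C a b c g f \<in> Hom C a c"
    and id: "\<And>a. a \<in> Obj C \<Longrightarrow> on_hom \<Phi> a a (Ident C a) = Ident D (on_obj \<Phi> a)"
    and comp: "\<And>a b c f g. \<lbrakk>a \<in> Obj C; b \<in> Obj C; c \<in> Obj C; f \<in> Hom C a b; g \<in> Hom C b c\<rbrakk>
      \<Longrightarrow> on_hom \<Phi> a c (Comp C a b c g f) =
        Comp D (on_obj \<Phi> a) (on_obj \<Phi> b) (on_obj \<Phi> c) (on_hom \<Phi> b c g) (on_hom \<Phi> a b f)"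
  shows "is_cat_isomorphism C D \<Phi>"
proof -
  have obj_in: "on_obj \<Phi> a \<in> Obj D" if "a \<in> Obj C" for a
    using obj that by (auto simp: bij_betw_def)
  have hom_in: "on_hom \<Phi> a b f \<in> Hom D (on_obj \<Phi> a) (on_obj \<Phi> b)"
    if "a \<in> Obj C" "b \<in> Obj C" "f \<in> Hom C a b" for a b f
    using hom[OF that(1,2)] that(3) by (auto simp: bij_betw_def)
  have inj: "f = g"
    if "a \<in> Obj C" "b \<in> Obj C" "f \<in> Hom C a b" "g \<in> Hom C a b" "on_hom \<Phi> a b f = on_hom \<Phi> a b g"
    for a b f g
    using hom[OF that(1,2)] that(3-5) by (auto simp: bij_betw_def inj_on_def)
  have D_unit: "Comp D a a b f (Ident D a) = f" "Comp D a b b (Ident D b) f = f"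
    if "a \<in> Obj D" "b \<in> Obj D" "f \<in> Hom D a b" for a b f
    using D that unfolding is_category_def by blast+
  have D_assoc: "Comp D a c d h (Comp D a b c g f) = Comp D a b d (Comp D b c d h g) f"
    if "a \<in> Obj D" "b \<in> Obj D" "c \<in> Obj D" "d \<in> Obj D" "f \<in> Hom D a b" "g \<in> Hom D b c" "h \<in> Hom D c d"
    for a b c d f g h
    using D that unfolding is_category_def by blast
  have C: "is_category C"
    unfolding is_category_def
  proof (intro conjI ballI)
    fix a b f assume [simp]: "a \<in> Obj C" "b \<in> Obj C" "f \<in> Hom C a b"
    show "Comp C a a b f (Ident C a) = f"
      by (rule inj[of a b]) (simp_all add: id_closed comp_closed comp id D_unit obj_in hom_in)
    show "Comp C a b b (Ident C b) f = f"
      by (rule inj[of a b]) (simp_all add: id_closed comp_closed comp id D_unit obj_in hom_in)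
  next
    fix a b c d f g h
    assume [simp]: "a \<in> Obj C" "b \<in> Obj C" "c \<in> Obj C" "d \<in> Obj C"
      and fgh [simp]: "f \<in> Hom C a b" "g \<in> Hom C b c" "h \<in> Hom C c d"
    have [simp]: "Comp C a b c g f \<in> Hom C a c" "Comp C b c d h g \<in> Hom C b d"
      using comp_closed[OF _ _ _ fgh(1,2)] comp_closed[OF _ _ _ fgh(2,3)] by simp_all
    show "Comp C a c d h (Comp C a b c g f) = Comp C a b d (Comp C b c d h g) f"
    proof (rule inj[of a d])
      show "on_hom \<Phi> a d (Comp C a c d h (Comp C a b c g f)) =
          on_hom \<Phi> a d (Comp C a b d (Comp C b c d h g) f)"
        using D_assoc[of "on_obj \<Phi> a" "on_obj \<Phi> b" "on_obj \<Phi> c" "on_obj \<Phi> d"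
            "on_hom \<Phi> a b f" "on_hom \<Phi> b c g" "on_hom \<Phi> c d h"]
        by (simp add: comp[of a c d] comp[of a b d] comp[of a b c] comp[of b c d] obj_in hom_in)
    qed (auto intro: comp_closed[of a c d] comp_closed[of a b d])
  qed (auto intro: id_closed comp_closed)
  have \<Phi>: "is_functor C D \<Phi>"
    unfolding is_functor_def using C D by (auto simp: obj_in hom_in id comp)
  define o' where "o' = inv_into (Obj C) (on_obj \<Phi>)"
  \<comment> \<open>Hom-sets may overlap, so the inverse on morphisms is taken separately for each
    pair of objects, with \<open>o'\<close> selecting the Hom-set to invert into.\<close>
  define G where "G = \<lparr>on_obj = o',
    on_hom = (\<lambda>x y. inv_into (Hom C (o' x) (o' y)) (on_hom \<Phi> (o' x) (o' y)))\<rparr>"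
  have G_sel: "on_obj G = o'"
      "on_hom G x y = inv_into (Hom C (o' x) (o' y)) (on_hom \<Phi> (o' x) (o' y))" for x y
    by (simp_all add: G_def)
  have o'_in: "o' x \<in> Obj C" and o'_inv: "on_obj \<Phi> (o' x) = x" if "x \<in> Obj D" for x
    using obj that by (auto simp: o'_def bij_betw_def inv_into_into f_inv_into_f)
  have o'_obj: "o' (on_obj \<Phi> a) = a" if "a \<in> Obj C" for a
    using obj that by (auto simp: o'_def bij_betw_def)
  have GF: "on_hom G (on_obj \<Phi> a) (on_obj \<Phi> b) (on_hom \<Phi> a b f) = f"
    if "a \<in> Obj C" "b \<in> Obj C" "f \<in> Hom C a b" for a b f
    using hom[OF that(1,2)] that by (simp add: G_sel o'_obj bij_betw_def)
  have hom': "bij_betw (on_hom \<Phi> (o' x) (o' y)) (Hom C (o' x) (o' y)) (Hom D x y)"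
    if "x \<in> Obj D" "y \<in> Obj D" for x y
    using hom[of "o' x" "o' y"] that by (simp add: o'_in o'_inv)
  have G_in: "on_hom G x y p \<in> Hom C (o' x) (o' y)"
    and FG: "on_hom \<Phi> (o' x) (o' y) (on_hom G x y p) = p"
    if "x \<in> Obj D" "y \<in> Obj D" "p \<in> Hom D x y" for x y p
    using hom'[OF that(1,2)] that(3)
    by (auto simp: G_sel bij_betw_def inv_into_into f_inv_into_f)
  have G: "is_functor D C G"
    unfolding is_functor_def
  proof (intro conjI ballI)
    fix x assume x: "x \<in> Obj D"
    show "on_hom G x x (Ident D x) = Ident C (on_obj G x)"
      using GF[of "o' x" "o' x" "Ident C (o' x)"] x
      by (simp add: o'_in o'_inv id id_closed G_sel(1))
  next
    fix x y z p q
    assume x: "x \<in> Obj D" "y \<in> Obj D" "z \<in> Obj D" and p: "p \<in> Hom D x y" and q: "q \<in> Hom D y z"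
    let ?p = "on_hom G x y p" and ?q = "on_hom G y z q"
    have pq: "?p \<in> Hom C (o' x) (o' y)" "?q \<in> Hom C (o' y) (o' z)"
      using G_in x p q by auto
    \<comment> \<open>Functoriality of \<open>G\<close> is checked in \<open>D\<close>: the
      composite of the preimages has image \<open>q\<close> after \<open>p\<close>, and
      \<open>GF\<close> then recovers it from that image.\<close>
    have "on_hom \<Phi> (o' x) (o' z) (Comp C (o' x) (o' y) (o' z) ?q ?p) = Comp D x y z q p"
      using comp[OF _ _ _ pq] x p q by (simp add: o'_in o'_inv FG)
    then show "on_hom G x z (Comp D x y z q p) = Comp C (on_obj G x) (on_obj G y) (on_obj G z) ?q ?p"
      using GF[of "o' x" "o' z" "Comp C (o' x) (o' y) (o' z) ?q ?p"] comp_closed[OF _ _ _ pq] x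
      by (simp add: o'_in o'_inv G_sel(1))
  qed (use C D G_in in \<open>auto simp: o'_in G_sel(1)\<close>)
  show ?thesis
    unfolding is_cat_isomorphism_def left_inverse_functor_def
    using \<Phi> G GF FG o'_obj o'_inv by (intro conjI exI[of _ G]) (auto simp: G_sel(1))
qed

lemma is_cat_isomorphism_imp_isomorphic:
  assumes "is_cat_isomorphism C D \<Phi>"
  shows "isomorphic_categories D C"
  using assms unfolding isomorphic_categories_def is_cat_isomorphism_def by blast


section \<open>Standard ppsets\<close>

lemma std_sel [simp]:
  "points (std n) = UNIV" "leq (std n) = {(x, y). x \<le> y}" "shift (std n) k x = x + k * (int n + 1)"
  by (simp_all add: std_def)

lemma inj_std: "inj std"
proof (rule injI)
  fix n m assume "std n = std m"
  then have "shift (std n) 1 0 = shift (std m) 1 0" by simp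
  then show "n = m" by simp
qed

lemma is_ppset_std: "is_ppset (std n)"
proof -
  have bij: "bij_betw (\<lambda>x. x + c) UNIV (UNIV :: int set)" for c
    by (rule bij_betwI[where g = "\<lambda>x. x - c"]) auto
  have sh: "shift (std n) = (\<lambda>k x. x + k * (int n + 1))"
    by (simp add: std_def)
  have Bij: "(\<lambda>x. x + c) \<in> Bij UNIV" for c :: int
    using bij by (simp add: Bij_def)
  have "shift (std n) \<in> hom integer_group (BijGroup UNIV)"
    unfolding hom_def sh
    by (auto simp: BijGroup_def Bij compose_def distrib_right)
  then have "group_action integer_group UNIV (shift (std n))"
    by (simp add: group_action_def group_hom_def group_hom_axioms_def group_BijGroup)
  then show ?thesis
    by (auto simp: is_ppset_def partial_order_on_def preorder_on_def refl_on_def trans_def antisym_def)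
qed

lemma ppmaps_std_iff:
  "f \<in> ppmaps (std n) (std m) \<longleftrightarrow> mono f \<and> (\<forall>x. f (x + (int n + 1)) = f x + (int m + 1))"
  by (auto simp: ppmaps_def mono_def)

text \<open>Commuting with the generator extends to every shift by induction on \<open>k\<close> in
  both directions from 0.\<close>

lemma ppmaps_std_shift:
  assumes "f \<in> ppmaps (std n) (std m)"
  shows "f (x + k * (int n + 1)) = f x + k * (int m + 1)"
proof -
  have step: "f (x + (int n + 1)) = f x + (int m + 1)" for x
    using assms by (simp add: ppmaps_std_iff)
  show ?thesis
  proof (induction k rule: int_induct[where k = 0])
    case (step1 i)
    then show ?case using step[of "x + i * (int n + 1)"] by (simp add: algebra_simps)
  next
    case (step2 i)
    then show ?case using step[of "x + (i - 1) * (int n + 1)"] by (simp add: algebra_simps)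
  qed simp
qed

lemma ppmaps_std_translate:
  assumes "f \<in> ppmaps (std n) (std m)"
  shows "(\<lambda>x. f (x + c)) \<in> ppmaps (std n) (std m)" "(\<lambda>x. f x + c) \<in> ppmaps (std n) (std m)"
proof -
  have "f (x + (int n + 1) + c) = f (x + c) + (int m + 1)" for x
    using assms by (metis ppmaps_std_iff add.commute add.left_commute)
  then show "(\<lambda>x. f (x + c)) \<in> ppmaps (std n) (std m)"
    using assms by (auto simp: ppmaps_std_iff mono_def)
  show "(\<lambda>x. f x + c) \<in> ppmaps (std n) (std m)"
    using assms by (auto simp: ppmaps_std_iff mono_def)
qed

lemma ppmaps_std_comp:
  assumes "f \<in> ppmaps (std n) (std m)" "g \<in> ppmaps (std m) (std k)"
  shows "(\<lambda>x. g (f x)) \<in> ppmaps (std n) (std k)"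
  using assms by (auto simp: ppmaps_std_iff mono_def)

lemma ppmaps_std_id: "(\<lambda>x. x) \<in> ppmaps (std n) (std n)"
  by (auto simp: ppmaps_std_iff mono_def)

section \<open>Morphism classes between standard ppsets\<close>

text \<open>By equivariance a shift of the source passes through \<open>f\<close> and becomes a
  shift of the target, so the two-sided equivalence leaves only target shifts.\<close>

lemma ppclass_std:
  assumes f: "f \<in> ppmaps (std n) (std m)"
  shows "ppclass (std n) (std m) f = range (\<lambda>k x. f x + k * (int m + 1))"
proof (intro equalityI subsetI)
  fix g assume "g \<in> ppclass (std n) (std m) f"
  then obtain j k where "\<forall>x. g x = f (x + k * (int n + 1)) + j * (int m + 1)"
    by (auto simp: ppclass_def pprel_def)
  then have "g = (\<lambda>x. f x + (j + k) * (int m + 1))"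
    unfolding ppmaps_std_shift[OF f] by (simp add: fun_eq_iff algebra_simps)
  then show "g \<in> range (\<lambda>k x. f x + k * (int m + 1))" by blast
next
  fix g assume "g \<in> range (\<lambda>k x. f x + k * (int m + 1))"
  then obtain j where g: "g = (\<lambda>x. f x + j * (int m + 1))" by blast
  then have "\<forall>x. g x = f (x + 0 * (int n + 1)) + j * (int m + 1)" by simp
  then show "g \<in> ppclass (std n) (std m) f"
    using f ppmaps_std_translate(2)[OF f, of "j * (int m + 1)"] g
    unfolding ppclass_def pprel_def std_sel by blast
qed

lemma ppclass_std_eq_iff:
  assumes "f \<in> ppmaps (std n) (std m)" "g \<in> ppmaps (std n) (std m)"
  shows "ppclass (std n) (std m) f = ppclass (std n) (std m) g \<longleftrightarrow>
    (\<exists>k. \<forall>x. f x = g x + k * (int m + 1))" (is "?L \<longleftrightarrow> ?R")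
proof
  assume ?L
  moreover have "f = (\<lambda>x. f x + 0 * (int m + 1))" by simp
  then have "f \<in> ppclass (std n) (std m) f"
    unfolding ppclass_std[OF assms(1)] by (rule range_eqI)
  ultimately show ?R
    by (auto simp: ppclass_std assms)
next
  assume ?R
  then obtain k where k: "f = (\<lambda>x. g x + k * (int m + 1))" by auto
  \<comment> \<open>Both classes are the same family of functions, reindexed by the bijection
    \<open>j \<mapsto> k + j\<close> of the integers.\<close>
  have "range (\<lambda>j x. f x + j * (int m + 1)) = range ((\<lambda>j x. g x + j * (int m + 1)) \<circ> (\<lambda>j. k + j))"
    by (simp add: k o_def algebra_simps)
  also have "\<dots> = range (\<lambda>j x. g x + j * (int m + 1))"
    unfolding image_comp[symmetric] by simp
  finally show ?L by (simp add: ppclass_std assms)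
qed

section \<open>The category of standard ppsets\<close>

lemma nabla_tilde_sel:
  "Obj nabla_tilde = range std"
  "Hom nabla_tilde (std n) (std m) = ppclass (std n) (std m) ` ppmaps (std n) (std m)"
  "Ident nabla_tilde (std n) = ppclass (std n) (std n) (\<lambda>x. x)"
proof -
  show "Obj nabla_tilde = range std"
    using is_ppset_std by (auto simp: nabla_tilde_def full_subcategory_def PP1_def)
  show "Hom nabla_tilde (std n) (std m) = ppclass (std n) (std m) ` ppmaps (std n) (std m)"
    by (auto simp: nabla_tilde_def full_subcategory_def PP1_def quotient_def ppclass_def)
  show "Ident nabla_tilde (std n) = ppclass (std n) (std n) (\<lambda>x. x)"
    by (simp add: nabla_tilde_def full_subcategory_def PP1_def restrict_def)
qed

text \<open>The union in the definition of composition is over a constant family: shifting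
  \<open>f\<close> by \<open>i\<close> periods and \<open>g\<close> by \<open>j\<close> periods
  shifts the composite by \<open>i + j\<close> periods of the last ppset.\<close>

lemma Comp_nabla_tilde:
  assumes f: "f \<in> ppmaps (std n) (std m)" and g: "g \<in> ppmaps (std m) (std k)"
  shows "Comp nabla_tilde (std n) (std m) (std k) (ppclass (std m) (std k) g) (ppclass (std n) (std m) f)
    = ppclass (std n) (std k) (\<lambda>x. g (f x))"
proof -
  have eq: "ppclass (std n) (std k) (\<lambda>x. g (f x + i * (int m + 1)) + j * (int k + 1)) =
      ppclass (std n) (std k) (\<lambda>x. g (f x))" for i j
  proof -
    have "(\<lambda>x. g (f x + i * (int m + 1)) + j * (int k + 1)) \<in> ppmaps (std n) (std k)"
      by (intro ppmaps_std_translate(2) ppmaps_std_comp[OF _ g] f)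
    then show ?thesis
      by (simp only: ppclass_std_eq_iff ppmaps_std_comp[OF f g] ppmaps_std_shift[OF g])
        (intro exI[of _ "i + j"] allI, simp add: algebra_simps)
  qed
  show ?thesis
    by (simp add: nabla_tilde_def full_subcategory_def PP1_def ppclass_std[OF f] ppclass_std[OF g]
        compose_def restrict_def eq)
qed

lemma is_category_nabla_tilde: "is_category nabla_tilde"
  unfolding is_category_def nabla_tilde_sel(1) ball_simps
  by (auto simp: nabla_tilde_sel Comp_nabla_tilde ppmaps_std_comp ppmaps_std_id)


section \<open>Lifts of monotone maps\<close>

lemma lift_of_nat [simp]: "a \<le> n \<Longrightarrow> lift n m \<chi> (int a) = int (\<chi> a)"
  using lift_apply[of a n m \<chi> 0] by simp

lemma split_residue:
  obtains a r where "a \<le> n" "x = int a + r * (int n + 1)"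
proof
  show "nat (x mod (int n + 1)) \<le> n"
    using pos_mod_bound[of "int n + 1" x] by linarith
  show "x = int (nat (x mod (int n + 1))) + (x div (int n + 1)) * (int n + 1)"
    by (simp add: mod_div_mult_eq)
qed

text \<open>An equivariant map is determined by its values on the single period
  \<open>{0..n}\<close>.\<close>

lemma lift_unique:
  assumes f: "f \<in> ppmaps (std n) (std m)" and \<chi>: "\<And>a. a \<le> n \<Longrightarrow> f (int a) = int (\<chi> a)"
  shows "lift n m \<chi> = f"
proof
  fix x
  obtain a r where "a \<le> n" "x = int a + r * (int n + 1)"
    by (rule split_residue)
  then show "lift n m \<chi> x = f x"
    using lift_apply[of a n m \<chi> r] \<chi>[of a] ppmaps_std_shift[OF f, of "int a" r] by simp
qed

lemma lift_in_ppmaps: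
  assumes "\<chi> \<in> hom_Delta n m"
  shows "lift n m \<chi> \<in> ppmaps (std n) (std m)"
proof -
  have bound: "\<chi> a \<le> m" if "a \<le> n" for a
    using assms that by (auto simp: hom_Delta_def PiE_iff)
  have mono: "\<chi> a \<le> \<chi> b" if "a \<le> b" "b \<le> n" for a b
    using assms that by (auto simp: hom_Delta_def mono_on_def)
  have "lift n m \<chi> x \<le> lift n m \<chi> y" if "x \<le> y" for x y
  proof -
    obtain a r where a: "a \<le> n" "x = int a + r * (int n + 1)" by (rule split_residue)
    obtain b s where b: "b \<le> n" "y = int b + s * (int n + 1)" by (rule split_residue)
    consider "r = s" "a \<le> b" | "r < s"
    proof (cases "r < s")
      case False
      moreover have "\<not> s < r"
      proof
        assume "s < r"
        \<comment> \<open>As \<open>b \<le> n\<close>, this puts \<open>y\<close> below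
          \<open>(s + 1) * (int n + 1)\<close> and hence below \<open>x\<close>.\<close>
        then have "(s + 1) * (int n + 1) \<le> r * (int n + 1)" by (intro mult_right_mono) auto
        then show False using a b \<open>x \<le> y\<close> by (simp add: algebra_simps)
      qed
      ultimately show ?thesis using a b \<open>x \<le> y\<close> by (intro that(1)) auto
    qed
    then have "int (\<chi> a) + r * (int m + 1) \<le> int (\<chi> b) + s * (int m + 1)"
    proof cases
      case 1
      then show ?thesis using mono[of a b] b by simp
    next
      case 2
      \<comment> \<open>Since \<open>\<chi> a \<le> m\<close>, the left value stays strictly below
        the start \<open>(r + 1) * (int m + 1)\<close> of the next target period.\<close>
      then have "(r + 1) * (int m + 1) \<le> s * (int m + 1)" by (intro mult_right_mono) auto
      then show ?thesis using bound[OF a(1)] by (simp add: algebra_simps)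
    qed
    then show ?thesis using a b by (simp add: lift_apply)
  qed
  moreover have "lift n m \<chi> (x + (int n + 1)) = lift n m \<chi> x + (int m + 1)" for x
  proof -
    obtain a r where a: "a \<le> n" "x = int a + r * (int n + 1)" by (rule split_residue)
    then have "x + (int n + 1) = int a + (r + 1) * (int n + 1)" by (simp add: algebra_simps)
    then show ?thesis
      using a lift_apply[of a n m \<chi> r] lift_apply[of a n m \<chi> "r + 1"] by (simp add: algebra_simps)
  qed
  ultimately show ?thesis by (simp add: ppmaps_std_iff mono_def)
qed

text \<open>A lift sends the \<open>k\<close>-th period of the source into the \<open>k\<close>-th
  period of the target. This normalization separates a lift from its translates and drives the
  injectivity argument.\<close>

lemma lift_ge_iff:
  assumes "\<chi> \<in> hom_Delta n m"
  shows "k * (int m + 1) \<le> lift n m \<chi> x \<longleftrightarrow> k * (int n + 1) \<le> x"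
proof -
  note l = lift_in_ppmaps[OF assms]
  have mono: "lift n m \<chi> x \<le> lift n m \<chi> y" if "x \<le> y" for x y
    using l that by (simp add: ppmaps_std_iff mono_def)
  have "\<chi> n \<le> m"
    using assms by (auto simp: hom_Delta_def PiE_iff)
  then have "lift n m \<chi> (int n + (k - 1) * (int n + 1)) < k * (int m + 1)"
    by (subst lift_apply) (simp_all add: algebra_simps)
  moreover have "k * (int m + 1) \<le> lift n m \<chi> (int 0 + k * (int n + 1))"
    by (subst lift_apply) simp_all
  moreover have "x \<le> int n + (k - 1) * (int n + 1)" if "\<not> k * (int n + 1) \<le> x"
    using that by (simp add: algebra_simps)
  ultimately show ?thesis
    using mono[of x "int n + (k - 1) * (int n + 1)"] mono[of "int 0 + k * (int n + 1)" x] by fastforce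
qed

lemma lift_idn: "lift n n (idn n) = (\<lambda>x. x)"
  by (rule lift_unique[OF ppmaps_std_id]) (simp add: idn_def)

lemma lift_compose:
  assumes "\<chi> \<in> hom_Delta n m" "\<phi> \<in> hom_Delta m k"
  shows "lift n k (compose {..n} \<phi> \<chi>) = (\<lambda>x. lift m k \<phi> (lift n m \<chi> x))"
proof (rule lift_unique[OF ppmaps_std_comp[OF lift_in_ppmaps[OF assms(1)] lift_in_ppmaps[OF assms(2)]]])
  fix a assume "a \<le> n"
  then show "lift m k \<phi> (lift n m \<chi> (int a)) = int (compose {..n} \<phi> \<chi> a)"
    using assms(1) by (auto simp: compose_def hom_Delta_def PiE_iff)
qed

lemma idn_in_hom_Delta: "idn n \<in> hom_Delta n n"
  by (auto simp: hom_Delta_def idn_def mono_on_def)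

lemma compose_in_hom_Delta:
  assumes "\<chi> \<in> hom_Delta n m" "\<phi> \<in> hom_Delta m k"
  shows "compose {..n} \<phi> \<chi> \<in> hom_Delta n k"
  using assms by (auto simp: hom_Delta_def PiE_iff compose_def mono_on_def)

text \<open>The translation is \<open>d = - y\<close> for the least \<open>y\<close> with
  \<open>f y \<ge> 0\<close>. Then \<open>f (y - 1) < 0\<close>, so one period later
  \<open>f (y + int n) \<le> int m\<close>, and monotonicity keeps all values on
  \<open>{y..y + int n}\<close> within \<open>{0..m}\<close>.\<close>

lemma ppmaps_std_eq_lift_translate:
  assumes f: "f \<in> ppmaps (std n) (std m)"
  obtains \<chi> d where "\<chi> \<in> hom_Delta n m" "f = (\<lambda>x. lift n m \<chi> (x + d))"
proof -
  have mono: "f x \<le> f y" if "x \<le> y" for x y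
    using f that by (simp add: ppmaps_std_iff mono_def)
  \<comment> \<open>Going back \<open>\<bar>f 0\<bar> + 1\<close> periods lowers the value by
    \<open>A + (int m + 1)\<close>, where \<open>A \<ge> \<bar>f 0\<bar>\<close>, so
    \<open>f lo\<close> is negative; going forward \<open>\<bar>f 0\<bar>\<close> periods makes the
    value nonnegative.\<close>
  define lo where "lo = - (\<bar>f 0\<bar> + 1) * (int n + 1)"
  define A where "A = \<bar>f 0\<bar> * (int m + 1)"
  have A: "\<bar>f 0\<bar> \<le> A"
    unfolding A_def using mult_left_mono[of 1 "int m + 1" "\<bar>f 0\<bar>"] by simp
  have "f (0 + - (\<bar>f 0\<bar> + 1) * (int n + 1)) = f 0 - A - (int m + 1)"
    unfolding ppmaps_std_shift[OF f] by (simp add: A_def algebra_simps)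
  moreover have "f (0 + \<bar>f 0\<bar> * (int n + 1)) = f 0 + A"
    unfolding ppmaps_std_shift[OF f] by (simp add: A_def)
  ultimately have "f (0 + - (\<bar>f 0\<bar> + 1) * (int n + 1)) < 0" "0 \<le> f (0 + \<bar>f 0\<bar> * (int n + 1))"
    using A by linarith+
  then have lo: "f lo < 0" and ex: "0 \<le> f (\<bar>f 0\<bar> * (int n + 1))"
    by (simp_all add: lo_def)
  \<comment> \<open>The integers are not well-ordered, so the minimum is taken over natural offsets
    from a point where \<open>f\<close> is negative.\<close>
  define j where "j = (LEAST i. 0 \<le> f (lo + int i))"
  have "0 \<le> f (lo + int (nat (\<bar>f 0\<bar> * (int n + 1) - lo)))"
  proof -
    have "lo \<le> \<bar>f 0\<bar> * (int n + 1)" using lo ex mono[of "\<bar>f 0\<bar> * (int n + 1)" lo] by linarith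
    then show ?thesis using ex by simp
  qed
  then have j: "0 \<le> f (lo + int j)" and j_min: "\<And>i. 0 \<le> f (lo + int i) \<Longrightarrow> j \<le> i"
    unfolding j_def by - (rule LeastI, assumption, rule Least_le)
  define y where "y = lo + int j"
  \<comment> \<open>A positive offset makes \<open>y - 1\<close> again \<open>lo\<close> plus a
    natural number, so minimality of \<open>j\<close> applies to it.\<close>
  have "j \<noteq> 0" using j lo by (intro notI) simp
  then have "y - 1 = lo + int (j - 1)" "\<not> j \<le> j - 1"
    by (simp_all add: y_def of_nat_diff)
  then have "f (y - 1) < 0"
    using j_min[of "j - 1"] by (simp only: not_le[symmetric]) blast
  then have top: "f (int n + y) \<le> int m"
    using ppmaps_std_shift[OF f, of "y - 1" 1] by (simp add: algebra_simps)
  define \<chi> where "\<chi> = (\<lambda>a\<in>{..n}. nat (f (int a + y)))"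
  have "0 \<le> f (int a + y)" for a
    using mono[of y "int a + y"] j by (simp add: y_def)
  then have \<chi>: "int (\<chi> a) = f (int a + y)" if "a \<le> n" for a
    using that by (simp add: \<chi>_def)
  have "\<chi> \<in> hom_Delta n m"
  proof -
    have "\<chi> a \<le> m" if "a \<le> n" for a
      using \<chi>[OF that] top mono[of "int a + y" "int n + y"] that by simp
    moreover have "\<chi> a \<le> \<chi> b" if "a \<le> b" "b \<le> n" for a b
      using \<chi>[of a] \<chi>[of b] mono[of "int a + y" "int b + y"] that by simp
    moreover have "\<chi> \<in> extensional {..n}" by (simp add: \<chi>_def)
    ultimately show ?thesis by (simp add: hom_Delta_def PiE_iff mono_on_def)
  qed
  moreover have "lift n m \<chi> = (\<lambda>x. f (x + y))"
    by (rule lift_unique[OF ppmaps_std_translate(1)[OF f]]) (simp add: \<chi>)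
  then have "f = (\<lambda>x. lift n m \<chi> (x + - y))" by simp
  ultimately show ?thesis by (rule that)
qed


section \<open>Cyclic permutations and the star operations\<close>

lemma int_cyc: "a \<le> n \<Longrightarrow> int (cyc n c a) = (int a + c) mod (int n + 1)"
  by (simp add: cyc_def)

lemma cyc_le: "a \<le> n \<Longrightarrow> cyc n c a \<le> n"
  using pos_mod_bound[of "int n + 1" "int a + c"] int_cyc[of a n c] by linarith

lemma cyc_extensional: "cyc n c \<in> extensional {..n}"
  by (simp add: cyc_def)

lemma idn_eq_cyc: "idn n = cyc n 0"
  by (rule extensionalityI[of _ "{..n}"]) (auto simp: idn_def cyc_def)

lemma compose_cyc: "compose {..n} (cyc n c) (cyc n d) = cyc n (c + d)"
proof (rule extensionalityI[of _ "{..n}"])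
  fix a assume "a \<in> {..n}"
  then have a: "a \<le> n" by simp
  have "int (cyc n c (cyc n d a)) = ((int a + d) mod (int n + 1) + c) mod (int n + 1)"
    by (simp add: int_cyc a cyc_le)
  also have "\<dots> = int (cyc n (c + d) a)"
    unfolding mod_add_left_eq by (simp add: int_cyc a ac_simps)
  finally show "compose {..n} (cyc n c) (cyc n d) a = cyc n (c + d) a"
    using a by (simp add: compose_def)
qed (simp_all add: cyc_extensional)

lemma cyc_eq_cong:
  assumes "c = d + k * (int n + 1)"
  shows "cyc n c = cyc n d"
proof -
  have "(int a + c) mod (int n + 1) = (int a + d) mod (int n + 1)" for a
    using mod_mult_self1[of "int a + d" k "int n + 1"] by (simp only: assms add.assoc)
  then show ?thesis by (simp add: cyc_def)
qed

lemma bij_cyc: "bij_betw (cyc n c) {..n} {..n}"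
proof -
  have inv: "cyc n d (cyc n (- d) a) = a" if "a \<le> n" for a d
    using compose_cyc[of n d "- d", THEN fun_cong, of a] that
    by (simp add: compose_def idn_eq_cyc[symmetric] idn_def)
  show ?thesis
    by (rule bij_betwI[where g = "cyc n (- c)"])
      (use inv[of _ c] inv[of _ "- c"] in \<open>auto simp: cyc_le\<close>)
qed

section \<open>Computing the star operations\<close>

text \<open>Supplies the uniqueness demanded by the definite description in
  \<open>upper_star\<close>, with \<open>R\<close> the new ordering.\<close>

lemma monotone_bij_atMost_unique:
  fixes \<sigma> \<tau> :: "nat \<Rightarrow> nat"
  assumes \<sigma>: "bij_betw \<sigma> {..n} {..n}" "\<And>a b. (a, b) \<in> R \<Longrightarrow> \<sigma> a \<le> \<sigma> b"
    and \<tau>: "bij_betw \<tau> {..n} {..n}" "\<And>a b. (a, b) \<in> R \<Longrightarrow> \<tau> a \<le> \<tau> b"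
    and total: "\<And>a b. a \<le> n \<Longrightarrow> b \<le> n \<Longrightarrow> (a, b) \<in> R \<or> (b, a) \<in> R"
    and a: "a \<le> n"
  shows "\<sigma> a = \<tau> a"
proof -
  text \<open>A bijection onto \<open>{..n}\<close> is recovered from the order it induces, as
    \<open>\<rho> a = card {b. \<rho> b < \<rho> a}\<close>.\<close>
  have rank: "\<rho> a = card {b \<in> {..n}. \<rho> b < \<rho> a}" if \<rho>: "bij_betw \<rho> {..n} {..n}" for \<rho> :: "nat \<Rightarrow> nat"
  proof -
    have inj: "inj_on \<rho> {..n}" and img: "\<rho> ` {..n} = {..n}"
      using \<rho> by (auto simp: bij_betw_def)
    have "\<rho> a \<le> n" using img a by blast
    have "\<rho> ` {b \<in> {..n}. \<rho> b < \<rho> a} = {..<\<rho> a}"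
    proof (intro equalityI subsetI)
      fix i assume i: "i \<in> {..<\<rho> a}"
      then have "i \<in> \<rho> ` {..n}" using \<open>\<rho> a \<le> n\<close> img by auto
      then show "i \<in> \<rho> ` {b \<in> {..n}. \<rho> b < \<rho> a}" using i by auto
    qed auto
    moreover have "inj_on \<rho> {b \<in> {..n}. \<rho> b < \<rho> a}"
      using inj by (rule inj_on_subset) auto
    ultimately show ?thesis by (metis card_image card_lessThan)
  qed
  \<comment> \<open>By totality and \<open>\<rho> b < \<rho> a\<close>, the pair
    \<open>(b, a)\<close> must lie in \<open>R\<close>, so \<open>\<upsilon>\<close> weakly
    preserves the order of \<open>b\<close> and \<open>a\<close>; injectivity makes this
    strict.\<close>
  have lt: "\<upsilon> b < \<upsilon> a" if "\<rho> b < \<rho> a" "b \<le> n" "bij_betw \<upsilon> {..n} {..n}"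
    "\<And>a b. (a, b) \<in> R \<Longrightarrow> \<rho> a \<le> \<rho> b" "\<And>a b. (a, b) \<in> R \<Longrightarrow> \<upsilon> a \<le> \<upsilon> b"
    for \<rho> \<upsilon> :: "nat \<Rightarrow> nat" and b
  proof -
    have "\<upsilon> b \<le> \<upsilon> a" using total[OF a that(2)] that(1) that(4,5) by fastforce
    moreover have "\<upsilon> b \<noteq> \<upsilon> a"
      using that(1-3) a by (auto simp: bij_betw_def inj_on_def)
    ultimately show ?thesis by simp
  qed
  have "{b \<in> {..n}. \<sigma> b < \<sigma> a} = {b \<in> {..n}. \<tau> b < \<tau> a}"
    using lt[of \<sigma> _ \<tau>] lt[of \<tau> _ \<sigma>] \<sigma> \<tau> by auto
  then show ?thesis using rank[OF \<sigma>(1)] rank[OF \<tau>(1)] by simp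
qed

text \<open>At \<open>int a\<close> the hypothesis splits into residue and quotient. The residues
  give \<open>u (\<chi> a) = \<chi>' (\<sigma> a)\<close> for \<open>u = cyc m c\<close> and
  \<open>\<sigma> = cyc n d\<close>, which orders different blocks correctly because
  \<open>\<chi>'\<close> is monotone; the quotients settle the order inside one block.\<close>

lemma star_eqI:
  assumes \<chi>: "\<chi> \<in> hom_Delta n m" and \<chi>': "\<chi>' \<in> hom_Delta n m"
    and eq: "\<And>x. lift n m \<chi> x + c = lift n m \<chi>' (x + d)"
  shows "upper_star n m \<chi> (cyc m c) = cyc n d" "lower_star n m (cyc m c) \<chi> = \<chi>'"
proof -
  let ?N = "int n + 1" and ?M = "int m + 1" and ?u = "cyc m c" and ?\<sigma> = "cyc n d"
  have bound: "\<chi> a \<le> m" "\<chi>' a \<le> m" if "a \<le> n" for a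
    using \<chi> \<chi>' that by (auto simp: hom_Delta_def PiE_iff)
  have mono': "\<chi>' a \<le> \<chi>' b" if "a \<le> b" "b \<le> n" for a b
    using \<chi>' that by (auto simp: hom_Delta_def mono_on_def)
  have split: "int (\<chi> a) + c = int (\<chi>' (?\<sigma> a)) + ((int a + d) div ?N) * ?M" if "a \<le> n" for a
    using eq[of "int a"] that by (simp add: lift_def cyc_def)
  have u\<chi>: "?u (\<chi> a) = \<chi>' (?\<sigma> a)" if "a \<le> n" for a
  proof -
    have "int (?u (\<chi> a)) = (int (\<chi>' (?\<sigma> a)) + ((int a + d) div ?N) * ?M) mod ?M"
      using split[OF that] bound(1)[OF that] by (simp add: int_cyc)
    also have "\<dots> = int (\<chi>' (?\<sigma> a))"
      using bound(2)[OF cyc_le[OF that]] by (simp add: mod_pos_pos_trivial)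
    finally show ?thesis by simp
  qed
  \<comment> \<open>Each \<open>a \<le> n\<close> lies in exactly one block, of index
    \<open>?u (\<chi> a) \<le> m\<close>, so the indices \<open>i\<close> and \<open>j\<close> can
    be eliminated.\<close>
  have order_iff: "(a, b) \<in> new_order n m ?u \<chi> \<longleftrightarrow>
      a \<le> n \<and> b \<le> n \<and> (?u (\<chi> a) < ?u (\<chi> b) \<or> ?u (\<chi> a) = ?u (\<chi> b) \<and> a \<le> b)" for a b
    using cyc_le[OF bound(1)] by (auto simp: new_order_def block_def)
  have total: "(a, b) \<in> new_order n m ?u \<chi> \<or> (b, a) \<in> new_order n m ?u \<chi>"
    if "a \<le> n" "b \<le> n" for a b
    using that by (auto simp: order_iff)
  have mono: "?\<sigma> a \<le> ?\<sigma> b" if "(a, b) \<in> new_order n m ?u \<chi>" for a b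
  \<comment> \<open>A reversed pair must lie in one block with \<open>a \<le> b\<close>. Then
    \<open>b\<close> wraps around at least once more than \<open>a\<close>, which forces
    \<open>\<chi> b - \<chi> a \<ge> m + 1\<close>, beyond the range of
    \<open>\<chi>\<close>.\<close>
  proof (rule ccontr)
    assume "\<not> ?\<sigma> a \<le> ?\<sigma> b"
    then have less: "?\<sigma> b < ?\<sigma> a" by simp
    have ab: "a \<le> n" "b \<le> n" using that by (auto simp: order_iff)
    have "\<chi>' (?\<sigma> b) \<le> \<chi>' (?\<sigma> a)" using mono' less cyc_le[OF ab(1)] by simp
    then have same: "\<chi>' (?\<sigma> a) = \<chi>' (?\<sigma> b)" and "a \<le> b"
      using that ab by (auto simp: order_iff u\<chi>)
    define r s where "r = (int a + d) div ?N" and "s = (int b + d) div ?N"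
    have "int a + d = int (?\<sigma> a) + r * ?N" "int b + d = int (?\<sigma> b) + s * ?N"
      by (simp_all add: r_def s_def int_cyc ab mod_div_mult_eq)
    then have "(s - r) * ?N > 0"
      using less \<open>a \<le> b\<close> by (simp add: algebra_simps)
    then have "s - r \<ge> 1" by (simp add: zero_less_mult_iff)
    then have "(s - r) * ?M \<ge> 1 * ?M" by (intro mult_right_mono) auto
    moreover have "int (\<chi> b) - int (\<chi> a) = (s - r) * ?M"
      using split[OF ab(1)] split[OF ab(2)] same by (simp add: r_def s_def algebra_simps)
    ultimately have "int m + 1 \<le> int (\<chi> b) - int (\<chi> a)" by simp
    then show False using bound(1)[OF ab(2)] by linarith
  qed
  show star: "upper_star n m \<chi> ?u = ?\<sigma>"
    unfolding upper_star_def
  proof (rule the_equality)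
    show "?\<sigma> \<in> extensional {..n} \<and> bij_betw ?\<sigma> {..n} {..n} \<and>
        (\<forall>(a, b) \<in> new_order n m ?u \<chi>. ?\<sigma> a \<le> ?\<sigma> b)"
      using mono by (auto simp: cyc_extensional bij_cyc)
    fix \<tau> assume \<tau>: "\<tau> \<in> extensional {..n} \<and> bij_betw \<tau> {..n} {..n} \<and>
        (\<forall>(a, b) \<in> new_order n m ?u \<chi>. \<tau> a \<le> \<tau> b)"
    show "\<tau> = ?\<sigma>"
    proof (rule extensionalityI[of _ "{..n}"])
      fix a assume "a \<in> {..n}"
      then show "\<tau> a = ?\<sigma> a"
        using \<tau> mono total bij_cyc
        by (intro monotone_bij_atMost_unique[of \<tau> n "new_order n m ?u \<chi>"]) auto
    qed (use \<tau> cyc_extensional in auto)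
  qed
  show "lower_star n m ?u \<chi> = \<chi>'"
    unfolding lower_star_def star
  proof (rule extensionalityI[of _ "{..n}"])
    fix a assume a: "a \<in> {..n}"
    \<comment> \<open>With \<open>a\<close> written as \<open>?\<sigma> b\<close>, the value to
      compute is \<open>?u (\<chi> b)\<close>, which is \<open>\<chi>' (?\<sigma> b)\<close> by
      \<open>u\<chi>\<close>.\<close>
    define b where "b = inv_into {..n} ?\<sigma> a"
    have "a \<in> ?\<sigma> ` {..n}"
      using a bij_cyc[of n d] by (simp add: bij_betw_def)
    then have "b \<in> {..n}" "?\<sigma> b = a"
      unfolding b_def by (rule inv_into_into, rule f_inv_into_f)
    then show "(\<lambda>a\<in>{..n}. ?u (\<chi> (inv_into {..n} ?\<sigma> a))) a = \<chi>' a"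
      using a u\<chi>[of b] by (simp add: b_def[symmetric])
  qed (use \<chi>' in \<open>auto simp: hom_Delta_def PiE_iff\<close>)
qed

text \<open>Factoring \<open>lift n m \<chi> x + c\<close> yields the data. The equation says that
  translation by \<open>c\<close> after \<open>\<chi>\<close> equals \<open>u\<^sub>*\<chi>\<close>
  after translation by \<open>d\<close>, the exchange rule behind composition in
  \<open>Delta_tilde\<close>.\<close>

lemma star_cyc:
  assumes "\<chi> \<in> hom_Delta n m"
  obtains d where "upper_star n m \<chi> (cyc m c) = cyc n d"
    "lower_star n m (cyc m c) \<chi> \<in> hom_Delta n m"
    "\<And>x. lift n m (lower_star n m (cyc m c) \<chi>) (x + d) = lift n m \<chi> x + c"
proof -
  obtain \<chi>' d where \<chi>': "\<chi>' \<in> hom_Delta n m"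
    and eq: "(\<lambda>x. lift n m \<chi> x + c) = (\<lambda>x. lift n m \<chi>' (x + d))"
    using ppmaps_std_translate(2)[OF lift_in_ppmaps[OF assms], of c]
    by (rule ppmaps_std_eq_lift_translate)
  note eq' = fun_cong[OF eq]
  show ?thesis
    using star_eqI[OF assms \<chi>' eq'] \<chi>' eq' by (intro that) simp_all
qed


section \<open>The isomorphism\<close>

lemma Delta_tilde_sel:
  "Obj Delta_tilde = UNIV"
  "Hom Delta_tilde n m = hom_Delta n m \<times> K n"
  "Ident Delta_tilde n = (idn n, idn n)"
  "Comp Delta_tilde n m k (\<phi>, u) (\<chi>, v) =
    (compose {..n} \<phi> (lower_star n m u \<chi>), compose {..n} (upper_star n m \<chi> u) v)"
  by (simp_all add: Delta_tilde_def)

text \<open>The representative \<open>cyc n c 0\<close> is \<open>c mod (int n + 1)\<close>, which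
  differs from \<open>c\<close> by a multiple of the period, that is, by a shift.\<close>

lemma F_K_cyc: "F_K n (cyc n c) = ppclass (std n) (std n) (\<lambda>x. x + c)"
proof -
  have "c mod (int n + 1) = c + (- (c div (int n + 1))) * (int n + 1)"
    by (simp add: minus_div_mult_eq_mod[symmetric])
  then have "\<exists>k. \<forall>x::int. x + int (cyc n c 0) = x + c + k * (int n + 1)"
    by (intro exI[of _ "- (c div (int n + 1))"]) (simp add: int_cyc)
  then show ?thesis
    unfolding F_K_def
    by (subst ppclass_std_eq_iff) (auto intro!: ppmaps_std_translate(2) ppmaps_std_id)
qed

lemma on_obj_F: "on_obj F = std"
  by (simp add: F_def)

lemma on_hom_F:
  assumes "\<chi> \<in> hom_Delta n m"
  shows "on_hom F n m (\<chi>, cyc n c) = ppclass (std n) (std m) (\<lambda>x. lift n m \<chi> (x + c))"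
  using Comp_nabla_tilde[OF ppmaps_std_translate(2)[OF ppmaps_std_id] lift_in_ppmaps[OF assms]]
  by (simp add: F_def F_Delta_def F_K_cyc)

lemma on_hom_F_idn:
  assumes "\<chi> \<in> hom_Delta n m"
  shows "on_hom F n m (\<chi>, idn n) = ppclass (std n) (std m) (lift n m \<chi>)"
  using on_hom_F[OF assms, of 0] by (simp add: idn_eq_cyc)

lemma on_hom_F_cyc: "on_hom F n n (idn n, cyc n c) = ppclass (std n) (std n) (\<lambda>x. x + c)"
  by (simp add: on_hom_F[OF idn_in_hom_Delta] lift_idn)

section \<open>Bijectivity on morphisms and compatibility with composition\<close>

text \<open>Equal classes agree up to \<open>k\<close> target shifts. Comparing where the two maps
  reach a multiple of the period fixes \<open>c'\<close> modulo \<open>n + 1\<close>; after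
  cancelling the translations the lifts coincide.\<close>

lemma inj_on_hom_F: "inj_on (on_hom F n m) (Hom Delta_tilde n m)"
proof (rule inj_onI)
  fix p q assume "p \<in> Hom Delta_tilde n m" "q \<in> Hom Delta_tilde n m"
    and eq: "on_hom F n m p = on_hom F n m q"
  then obtain \<chi> c \<chi>' c' where p: "p = (\<chi>, cyc n c)" and q: "q = (\<chi>', cyc n c')"
    and \<chi>: "\<chi> \<in> hom_Delta n m" and \<chi>': "\<chi>' \<in> hom_Delta n m"
    by (auto simp: Delta_tilde_sel K_def)
  have "ppclass (std n) (std m) (\<lambda>x. lift n m \<chi> (x + c)) =
      ppclass (std n) (std m) (\<lambda>x. lift n m \<chi>' (x + c'))"
    using eq by (simp add: p q on_hom_F \<chi> \<chi>')
  then obtain k where k: "lift n m \<chi> (x + c) = lift n m \<chi>' (x + c') + k * (int m + 1)" for x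
    by (subst (asm) ppclass_std_eq_iff)
      (auto intro!: ppmaps_std_translate(1) lift_in_ppmaps \<chi> \<chi>')
  have "0 \<le> lift n m \<chi> (x + c) \<longleftrightarrow> - k * (int m + 1) \<le> lift n m \<chi>' (x + c')" for x
    using k[of x] by auto
  then have ge: "0 \<le> x + c \<longleftrightarrow> - k * (int n + 1) \<le> x + c'" for x
    using lift_ge_iff[OF \<chi>, of 0 "x + c"] lift_ge_iff[OF \<chi>', of "- k" "x + c'"] by simp
  \<comment> \<open>Each of the two arguments makes one side of \<open>ge\<close> an equality, and
    the resulting inequalities are opposite.\<close>
  have c: "c' = c + - k * (int n + 1)"
    using ge[of "- c"] ge[of "- c' - k * (int n + 1)"] by (simp add: algebra_simps)
  have "lift n m \<chi> y = lift n m \<chi>' y" for y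
    using k[of "y - c"] ppmaps_std_shift[OF lift_in_ppmaps[OF \<chi>'], of y "- k"]
    by (simp add: c algebra_simps)
  then have "\<chi> a = \<chi>' a" if "a \<le> n" for a
    using that by (metis lift_of_nat of_nat_eq_iff)
  then have "\<chi> = \<chi>'"
    using \<chi> \<chi>' by (intro extensionalityI[of _ "{..n}"]) (auto simp: hom_Delta_def PiE_iff)
  then show "p = q"
    using cyc_eq_cong[OF c] by (simp add: p q)
qed

text \<open>Surjectivity is the factorization of a representative as a lift after a
  translation.\<close>

lemma image_on_hom_F:
  "on_hom F n m ` Hom Delta_tilde n m = Hom nabla_tilde (std n) (std m)"
proof (intro equalityI subsetI)
  fix X assume "X \<in> on_hom F n m ` Hom Delta_tilde n m"
  then obtain \<chi> c where "\<chi> \<in> hom_Delta n m" "X = on_hom F n m (\<chi>, cyc n c)"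
    by (auto simp: Delta_tilde_sel K_def)
  then show "X \<in> Hom nabla_tilde (std n) (std m)"
    by (auto simp: on_hom_F nabla_tilde_sel intro!: imageI ppmaps_std_translate(1) lift_in_ppmaps)
next
  fix X assume "X \<in> Hom nabla_tilde (std n) (std m)"
  then obtain f where f: "f \<in> ppmaps (std n) (std m)" and X: "X = ppclass (std n) (std m) f"
    by (auto simp: nabla_tilde_sel)
  obtain \<chi> d where "\<chi> \<in> hom_Delta n m" "f = (\<lambda>x. lift n m \<chi> (x + d))"
    using f by (rule ppmaps_std_eq_lift_translate)
  then have "X = on_hom F n m (\<chi>, cyc n d)" "(\<chi>, cyc n d) \<in> Hom Delta_tilde n m"
    by (simp_all add: X on_hom_F Delta_tilde_sel K_def)
  then show "X \<in> on_hom F n m ` Hom Delta_tilde n m" by (rule image_eqI)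
qed

text \<open>The composite of representatives is
  \<open>lift m k \<phi> (lift n m \<chi> (x + e) + c)\<close>. The exchange rule moves
  \<open>c\<close> to the right as \<open>d\<close>, giving the lift of \<open>\<phi>\<close> after
  \<open>u\<^sub>*\<chi>\<close>, precomposed with translation by \<open>d + e\<close>.\<close>

lemma Comp_Delta_tilde:
  assumes p: "p \<in> Hom Delta_tilde n m" and q: "q \<in> Hom Delta_tilde m k"
  shows Comp_Delta_tilde_closed: "Comp Delta_tilde n m k q p \<in> Hom Delta_tilde n k"
    and on_hom_F_Comp: "on_hom F n k (Comp Delta_tilde n m k q p) =
      Comp nabla_tilde (std n) (std m) (std k) (on_hom F m k q) (on_hom F n m p)"
proof -
  obtain \<chi> e where \<chi>: "\<chi> \<in> hom_Delta n m" and p: "p = (\<chi>, cyc n e)"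
    using p by (auto simp: Delta_tilde_sel K_def)
  obtain \<phi> c where \<phi>: "\<phi> \<in> hom_Delta m k" and q: "q = (\<phi>, cyc m c)"
    using q by (auto simp: Delta_tilde_sel K_def)
  obtain d where d: "upper_star n m \<chi> (cyc m c) = cyc n d"
    and \<chi>': "lower_star n m (cyc m c) \<chi> \<in> hom_Delta n m"
    and eq: "\<And>x. lift n m (lower_star n m (cyc m c) \<chi>) (x + d) = lift n m \<chi> x + c"
    using star_cyc[OF \<chi>] by blast
  have qp: "Comp Delta_tilde n m k q p =
      (compose {..n} \<phi> (lower_star n m (cyc m c) \<chi>), cyc n (d + e))"
    by (simp add: p q Delta_tilde_sel d compose_cyc)
  show "Comp Delta_tilde n m k q p \<in> Hom Delta_tilde n k"
    using compose_in_hom_Delta[OF \<chi>' \<phi>] by (simp add: qp Delta_tilde_sel K_def)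
  have "on_hom F n k (Comp Delta_tilde n m k q p) =
      ppclass (std n) (std k) (\<lambda>x. lift m k \<phi> (lift n m \<chi> (x + e) + c))"
    unfolding qp on_hom_F[OF compose_in_hom_Delta[OF \<chi>' \<phi>]] lift_compose[OF \<chi>' \<phi>]
    using eq[of "_ + e"] by (simp add: algebra_simps)
  also have "\<dots> = Comp nabla_tilde (std n) (std m) (std k) (on_hom F m k q) (on_hom F n m p)"
    unfolding p q on_hom_F[OF \<chi>] on_hom_F[OF \<phi>]
    by (rule Comp_nabla_tilde[symmetric]) (intro ppmaps_std_translate(1) lift_in_ppmaps \<chi> \<phi>)+
  finally show "on_hom F n k (Comp Delta_tilde n m k q p) =
      Comp nabla_tilde (std n) (std m) (std k) (on_hom F m k q) (on_hom F n m p)" .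
qed

lemma is_cat_isomorphism_F: "is_cat_isomorphism Delta_tilde nabla_tilde F"
proof (rule is_cat_isomorphismI)
  show "bij_betw (on_obj F) (Obj Delta_tilde) (Obj nabla_tilde)"
    using inj_std by (simp add: on_obj_F Delta_tilde_sel nabla_tilde_sel bij_betw_def)
  show "bij_betw (on_hom F n m) (Hom Delta_tilde n m) (Hom nabla_tilde (on_obj F n) (on_obj F m))" for n m
    by (simp add: on_obj_F bij_betw_def inj_on_hom_F image_on_hom_F)
  show "Ident Delta_tilde n \<in> Hom Delta_tilde n n" for n
    using idn_in_hom_Delta by (simp add: Delta_tilde_sel K_def) (simp add: idn_eq_cyc)
  show "on_hom F n n (Ident Delta_tilde n) = Ident nabla_tilde (on_obj F n)" for n
    by (simp add: Delta_tilde_sel nabla_tilde_sel on_obj_F on_hom_F_idn idn_in_hom_Delta lift_idn)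
qed (simp_all add: is_category_nabla_tilde Comp_Delta_tilde on_obj_F)

theorem theorem5p3:
  shows "isomorphic_categories nabla_tilde Delta_tilde \<and>
    is_cat_isomorphism Delta_tilde nabla_tilde F \<and>
    (\<forall>n. on_obj F n = std n) \<and>
    (\<forall>n m. \<forall>\<chi>\<in>hom_Delta n m.
      (\<forall>a<n + 1. \<forall>r::int. lift n m \<chi> (int a + r * (int n + 1)) = int (\<chi> a) + r * (int m + 1)) \<and>
      on_hom F n m (\<chi>, idn n) = ppclass (std n) (std m) (lift n m \<chi>)) \<and>
    (\<forall>n. \<forall>c::int. on_hom F n n (idn n, cyc n c) = ppclass (std n) (std n) (\<lambda>x. x + c)) \<and>
    (\<forall>n m. \<forall>\<chi>\<in>hom_Delta n m. \<forall>u\<in>K n.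
      Comp Delta_tilde n n m (\<chi>, idn n) (idn n, u) = (\<chi>, u) \<and>
      on_hom F n m (\<chi>, u) =
        Comp nabla_tilde (std n) (std n) (std m)
          (on_hom F n m (\<chi>, idn n)) (on_hom F n n (idn n, u)))"
proof (intro conjI allI ballI impI)
  show "isomorphic_categories nabla_tilde Delta_tilde"
    using is_cat_isomorphism_F by (rule is_cat_isomorphism_imp_isomorphic)
  fix n m \<chi> u assume \<chi>: "\<chi> \<in> hom_Delta n m" and u: "u \<in> K n"
  obtain c where c: "u = cyc n c" using u by (auto simp: K_def)
  have hom: "(\<chi>, u) \<in> Hom Delta_tilde n m" "(\<chi>, idn n) \<in> Hom Delta_tilde n m"
    "(idn n, u) \<in> Hom Delta_tilde n n"
    using \<chi> u idn_in_hom_Delta by (auto simp: Delta_tilde_sel K_def idn_eq_cyc)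
  show F_eq: "on_hom F n m (\<chi>, u) = Comp nabla_tilde (std n) (std n) (std m)
      (on_hom F n m (\<chi>, idn n)) (on_hom F n n (idn n, u))"
    using Comp_nabla_tilde[OF ppmaps_std_translate(2)[OF ppmaps_std_id] lift_in_ppmaps[OF \<chi>]]
    by (simp add: c on_hom_F on_hom_F_idn on_hom_F_cyc \<chi>)
  \<comment> \<open>Instead of evaluating the stars at identities, both sides are compared under
    \<open>F\<close>, which is injective on this Hom-set.\<close>
  show "Comp Delta_tilde n n m (\<chi>, idn n) (idn n, u) = (\<chi>, u)"
    using hom F_eq
    by (intro inj_onD[OF inj_on_hom_F[of n m]]) (simp_all add: on_hom_F_Comp Comp_Delta_tilde_closed)
qed (use lift_apply in \<open>simp_all add: is_cat_isomorphism_F on_obj_F on_hom_F_idn on_hom_F_cyc\<close>)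

end
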